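(* For every hyperbolic digraph $D$ that satisfies (B1) and (B2) the following hold. (i) If every vertex of $D$ has finite out-degree, then the geodesic f-boundary is a refinement of the f-ends. (ii) If every vertex of $D$ has finite in-degree, then the geodesic b-boundary is a refinement of the b-ends. (iii) If $D$ is locally finite, then the geodesic boundary is a refinement of the ends.
   Context: Digraphs may have loops, parallel edges and oppositely oriented edges. A directed path in $D$ is a sequence $x_0\ldots x_n$ of vertices with every $x_ix_{i+1}$ an edge; its length is $n$. $d(x,y)$ is the length of a shortest directed path from $x$ to $y$, or $\infty$ if there is none. $D$ is regarded as the semimetric space $(V(D),d)$ with these directed paths; a directed path from $x$ to $y$ is a geodesic if its length is $d(x,y)$. The out-degree (in-degree) of $x$ is the number of $y$ with $d(x,y)=1$ ($d(y,x)=1$); $D$ is locally finite if all in- and out-degrees are finite. $\mathcal B^+_r(x)=\{y: d(x,y)\le r\}$, $\mathcal B^-_r(x)=\{y:d(y,x)\le r\}$, and $\mathcal B^\pm_r(Y)=\bigcup_{y\in Y}\mathcal B^\pm_r(y)$. A geodesic triangle consists of three points and three geodesics (its sides), one between every two of these points (in one of the two directions). It is $\delta$-thin if for every labelling $P,Q,R$ of its sides such that the starting point of $P$ is the starting or the end point of $Q$ and the end point of $P$ is the starting or the end point of $R$, we have $P\subseteq\mathcal B^+_\delta(Q)\cup\mathcal B^-_\delta(R)$. $D$ is hyperbolic if for some $\delta\ge0$ all geodesic triangles are $\delta$-thin. (B1): there is $f\colon\mathbb R\to\mathbb R$ such that for all $x$, $r\ge0$ and $y,z\in\mathcal B^+_r(x)$,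 $d(y,z)$ is either $\infty$ or at most $f(r)$. (B2): the same with $\mathcal B^-_r(x)$ in place of $\mathcal B^+_r(x)$. A ray is a sequence $x_0x_1\ldots$ of distinct vertices with edges $x_ix_{i+1}$; an anti-ray is such a sequence with edges $x_{i+1}x_i$. A (anti-)ray is geodesic if all its finite directed subpaths are geodesics. For geodesic rays or anti-rays $R_1,R_2$ write $R_1\le R_2$ if there is $M\ge0$ such that for every $r\ge0$ and every $x$ there is a directed path from $R_1$ to $R_2$ of length at most $M$ outside of $\mathcal B^+_r(x)\cup\mathcal B^-_r(x)$; $R_1\approx R_2$ means $R_1\le R_2\le R_1$. Under the hypotheses this is an equivalence relation. The geodesic boundary (f-boundary, b-boundary) is the set of classes of $\approx$ on geodesic rays and anti-rays (geodesic rays, geodesic anti-rays). For arbitrary rays or anti-rays write $R_1\preccurlyeq R_2$ if there are infinitely many pairwise disjoint directed paths from $R_1$ to $R_2$; this is a quasiorder, and $R_1\sim R_2$ means $R_1\preccurlyeq R_2\preccurlyeq R_1$. The ends (f-ends, b-ends) are the classes of $\sim$ on all rays and anti-rays (rays, anti-rays). The geodesic (f-, b-)boundary is a refinement of the (f-, b-)ends if every geodesic (f-, b-)boundary point is contained as a set in some (f-, b-)end and every (f-, b-)end contains at least one geodesic (f-, b-)boundary point. *)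

theory Defs
  imports Complex_Main "HOL-Library.Multiset" "HOL-Library.Extended_Real"
    "Graph_Theory.Digraph" "Graph_Theory.Vertex_Walk"
begin

text \<open>
  A digraph is a (possibly infinite) \<^const>\<open>wf_digraph\<close>, so loops and parallel
  arcs are allowed.  Directed paths are the vertex walks \<^const>\<open>vwalk\<close> of the library:
  non-empty vertex sequences in which vertices may be repeated.
\<close>

definition path_from_to :: "('a,'b) pre_digraph \<Rightarrow> 'a set \<Rightarrow> 'a set \<Rightarrow> 'a list \<Rightarrow> bool" where
  "path_from_to D X Y p \<longleftrightarrow> vwalk p D \<and> hd p \<in> X \<and> last p \<in> Y"

text \<open>The infimum over the empty set is \<open>\<infinity>\<close>.\<close>
definition ddist :: "('a,'b) pre_digraph \<Rightarrow> 'a \<Rightarrow> 'a \<Rightarrow> enat" where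
  "ddist D x y = (INF p \<in> {p. path_from_to D {x} {y} p}. enat (vwalk_length p))"

definition geodesic :: "('a,'b) pre_digraph \<Rightarrow> 'a list \<Rightarrow> bool" where
  "geodesic D p \<longleftrightarrow> vwalk p D \<and> enat (vwalk_length p) = ddist D (hd p) (last p)"

text \<open>Degrees count neighbours at distance 1, not arcs: loops and multiplicities are ignored.\<close>
definition finite_out_degrees :: "('a,'b) pre_digraph \<Rightarrow> bool" where
  "finite_out_degrees D \<longleftrightarrow> (\<forall>x \<in> verts D. finite {y \<in> verts D. ddist D x y = 1})"

definition finite_in_degrees :: "('a,'b) pre_digraph \<Rightarrow> bool" where
  "finite_in_degrees D \<longleftrightarrow> (\<forall>x \<in> verts D. finite {y \<in> verts D. ddist D y x = 1})"

definition locally_finite :: "('a,'b) pre_digraph \<Rightarrow> bool" where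
  "locally_finite D \<longleftrightarrow> finite_out_degrees D \<and> finite_in_degrees D"

definition out_ball :: "('a,'b) pre_digraph \<Rightarrow> real \<Rightarrow> 'a \<Rightarrow> 'a set" where
  "out_ball D r x = {y \<in> verts D. ereal_of_enat (ddist D x y) \<le> ereal r}"

definition in_ball :: "('a,'b) pre_digraph \<Rightarrow> real \<Rightarrow> 'a \<Rightarrow> 'a set" where
  "in_ball D r x = {y \<in> verts D. ereal_of_enat (ddist D y x) \<le> ereal r}"

definition geodesic_between :: "('a,'b) pre_digraph \<Rightarrow> 'a \<Rightarrow> 'a \<Rightarrow> 'a list \<Rightarrow> bool" where
  "geodesic_between D x y p \<longleftrightarrow>
     geodesic D p \<and> (hd p = x \<and> last p = y \<or> hd p = y \<and> last p = x)"

text \<open>The three points are not required to be distinct.\<close>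
definition geodesic_triangle ::
    "('a,'b) pre_digraph \<Rightarrow> 'a \<Rightarrow> 'a \<Rightarrow> 'a \<Rightarrow> 'a list \<Rightarrow> 'a list \<Rightarrow> 'a list \<Rightarrow> bool" where
  "geodesic_triangle D x y z A B C \<longleftrightarrow>
     x \<in> verts D \<and> y \<in> verts D \<and> z \<in> verts D \<and>
     geodesic_between D x y A \<and> geodesic_between D y z B \<and> geodesic_between D z x C"

text \<open>The multiset equation says that \<open>P, Q, R\<close> is a relabelling of the sides \<open>A, B, C\<close>.\<close>
definition thin ::
    "('a,'b) pre_digraph \<Rightarrow> real \<Rightarrow> 'a list \<Rightarrow> 'a list \<Rightarrow> 'a list \<Rightarrow> bool" where
  "thin D \<delta> A B C \<longleftrightarrow>
     (\<forall>P Q R. {#P, Q, R#} = {#A, B, C#} \<longrightarrow>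
        hd P \<in> {hd Q, last Q} \<longrightarrow> last P \<in> {hd R, last R} \<longrightarrow>
        set P \<subseteq> (\<Union>q \<in> set Q. out_ball D \<delta> q) \<union> (\<Union>q \<in> set R. in_ball D \<delta> q))"

definition hyperbolic :: "('a,'b) pre_digraph \<Rightarrow> bool" where
  "hyperbolic D \<longleftrightarrow>
     (\<exists>\<delta>\<ge>0. \<forall>x y z A B C. geodesic_triangle D x y z A B C \<longrightarrow> thin D \<delta> A B C)"

definition B1 :: "('a,'b) pre_digraph \<Rightarrow> bool" where
  "B1 D \<longleftrightarrow> (\<exists>f :: real \<Rightarrow> real. \<forall>x \<in> verts D. \<forall>r\<ge>0. \<forall>y \<in> out_ball D r x. \<forall>z \<in> out_ball D r x.
     ddist D y z = \<infinity> \<or> ereal_of_enat (ddist D y z) \<le> ereal (f r))"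

definition B2 :: "('a,'b) pre_digraph \<Rightarrow> bool" where
  "B2 D \<longleftrightarrow> (\<exists>f :: real \<Rightarrow> real. \<forall>x \<in> verts D. \<forall>r\<ge>0. \<forall>y \<in> in_ball D r x. \<forall>z \<in> in_ball D r x.
     ddist D y z = \<infinity> \<or> ereal_of_enat (ddist D y z) \<le> ereal (f r))"

definition rays :: "('a,'b) pre_digraph \<Rightarrow> (nat \<Rightarrow> 'a) set" where
  "rays D = {R. inj R \<and> range R \<subseteq> verts D \<and> (\<forall>i. R i \<rightarrow>\<^bsub>D\<^esub> R (Suc i))}"

definition anti_rays :: "('a,'b) pre_digraph \<Rightarrow> (nat \<Rightarrow> 'a) set" where
  "anti_rays D = {R. inj R \<and> range R \<subseteq> verts D \<and> (\<forall>i. R (Suc i) \<rightarrow>\<^bsub>D\<^esub> R i)}"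

definition geodesic_rays :: "('a,'b) pre_digraph \<Rightarrow> (nat \<Rightarrow> 'a) set" where
  "geodesic_rays D = {R \<in> rays D. \<forall>m n. m \<le> n \<longrightarrow> geodesic D (map R [m..<Suc n])}"

text \<open>The directed subpaths of an anti-ray run against the indexing.\<close>
definition geodesic_anti_rays :: "('a,'b) pre_digraph \<Rightarrow> (nat \<Rightarrow> 'a) set" where
  "geodesic_anti_rays D =
     {R \<in> anti_rays D. \<forall>m n. m \<le> n \<longrightarrow> geodesic D (rev (map R [m..<Suc n]))}"

text \<open>The relations \<open>\<le>\<close> and \<open>\<approx>\<close>, used for geodesic rays and anti-rays.\<close>
definition geo_le :: "('a,'b) pre_digraph \<Rightarrow> (nat \<Rightarrow> 'a) \<Rightarrow> (nat \<Rightarrow> 'a) \<Rightarrow> bool" where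
  "geo_le D R1 R2 \<longleftrightarrow> (\<exists>M::real. M \<ge> 0 \<and> (\<forall>r\<ge>0. \<forall>x \<in> verts D. \<exists>p.
     path_from_to D (range R1) (range R2) p \<and> real (vwalk_length p) \<le> M \<and>
     set p \<inter> (out_ball D r x \<union> in_ball D r x) = {}))"

definition geo_equiv :: "('a,'b) pre_digraph \<Rightarrow> (nat \<Rightarrow> 'a) \<Rightarrow> (nat \<Rightarrow> 'a) \<Rightarrow> bool" where
  "geo_equiv D R1 R2 \<longleftrightarrow> geo_le D R1 R2 \<and> geo_le D R2 R1"

text \<open>The relations \<open>\<preccurlyeq>\<close> and \<open>\<sim>\<close>, used for arbitrary rays and anti-rays.\<close>
definition end_le :: "('a,'b) pre_digraph \<Rightarrow> (nat \<Rightarrow> 'a) \<Rightarrow> (nat \<Rightarrow> 'a) \<Rightarrow> bool" where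
  "end_le D R1 R2 \<longleftrightarrow> (\<exists>\<P>. infinite \<P> \<and>
     (\<forall>p \<in> \<P>. path_from_to D (range R1) (range R2) p) \<and>
     pairwise (\<lambda>p q. set p \<inter> set q = {}) \<P>)"

definition end_equiv :: "('a,'b) pre_digraph \<Rightarrow> (nat \<Rightarrow> 'a) \<Rightarrow> (nat \<Rightarrow> 'a) \<Rightarrow> bool" where
  "end_equiv D R1 R2 \<longleftrightarrow> end_le D R1 R2 \<and> end_le D R2 R1"

definition classes_on :: "'c set \<Rightarrow> ('c \<Rightarrow> 'c \<Rightarrow> bool) \<Rightarrow> 'c set set" where
  "classes_on X E = X // {(R1, R2). R1 \<in> X \<and> R2 \<in> X \<and> E R1 R2}"

definition geodesic_boundary :: "('a,'b) pre_digraph \<Rightarrow> (nat \<Rightarrow> 'a) set set" where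
  "geodesic_boundary D = classes_on (geodesic_rays D \<union> geodesic_anti_rays D) (geo_equiv D)"

definition geodesic_f_boundary :: "('a,'b) pre_digraph \<Rightarrow> (nat \<Rightarrow> 'a) set set" where
  "geodesic_f_boundary D = classes_on (geodesic_rays D) (geo_equiv D)"

definition geodesic_b_boundary :: "('a,'b) pre_digraph \<Rightarrow> (nat \<Rightarrow> 'a) set set" where
  "geodesic_b_boundary D = classes_on (geodesic_anti_rays D) (geo_equiv D)"

definition ends :: "('a,'b) pre_digraph \<Rightarrow> (nat \<Rightarrow> 'a) set set" where
  "ends D = classes_on (rays D \<union> anti_rays D) (end_equiv D)"

definition f_ends :: "('a,'b) pre_digraph \<Rightarrow> (nat \<Rightarrow> 'a) set set" where
  "f_ends D = classes_on (rays D) (end_equiv D)"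

definition b_ends :: "('a,'b) pre_digraph \<Rightarrow> (nat \<Rightarrow> 'a) set set" where
  "b_ends D = classes_on (anti_rays D) (end_equiv D)"

definition refinement :: "'c set set \<Rightarrow> 'c set set \<Rightarrow> bool" where
  "refinement \<B> \<E> \<longleftrightarrow> (\<forall>\<eta> \<in> \<B>. \<exists>\<omega> \<in> \<E>. \<eta> \<subseteq> \<omega>) \<and> (\<forall>\<omega> \<in> \<E>. \<exists>\<eta> \<in> \<B>. \<eta> \<subseteq> \<omega>)"

end

theory Submission
  imports Defs
begin

text \<open>
  The relation \<open>end_le\<close> between two rays or anti-rays holds iff, for every finite set \<open>U\<close>, some
  directed path from the first to the second avoids \<open>U\<close> (\<open>end_le_iff\<close>). In this form it is
  seen to be transitive and to follow from \<open>geo_le\<close>: the part of a finite set that is reachable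
  from a ray or anti-ray lies in one ball, and \<open>geo_le\<close> provides paths outside of that ball
  (\<open>geo_le_imp_end_le\<close>). Equivalent geodesic rays or anti-rays thus belong to the same end.

  It remains to find in every end a geodesic ray or anti-ray. Let \<open>R\<close> be a ray in a digraph of
  finite out-degrees. Geodesics \<open>P m\<close> from \<open>R 0\<close> to \<open>R m\<close> subconverge, by Koenig's lemma, to a
  geodesic ray \<open>G\<close>. The final segments of those \<open>P m\<close> that follow \<open>G\<close> for long lead from \<open>G\<close>
  to \<open>R\<close> far away from \<open>R 0\<close>, so \<open>end_le D G R\<close> (\<open>end_le_of_geodesic_limit\<close>).

  The converse \<open>end_le D R G\<close> is where hyperbolicity enters, since paths cannot be reversed in
  general. Thinness of the triangles with sides \<open>P n\<close> and \<open>P m\<close> shows that every vertex of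
  \<open>R\<close> reaches \<open>G\<close> by some path (\<open>reaches_geodesic_limit\<close>). If all such paths
  met one finite set \<open>U\<close>, then some vertex of \<open>U\<close>, a tail of \<open>R\<close> and a tail of \<open>G\<close> would lie in
  the same strong component. Within a strong component (B1) bounds the distance from the head of
  an arc back to its tail by a constant. Hence a path from \<open>G\<close> to \<open>R\<close> far away from \<open>U\<close> can be
  reversed, arc by arc, without meeting \<open>U\<close>: a contradiction (\<open>end_le_converse\<close>).

  Anti-rays are rays of the digraph with all arcs reversed. Reversal preserves hyperbolicity,
  exchanges in- and out-degrees, and turns (B2) into (B1).
\<close>

section \<open>Directed paths and distances\<close>

lemma vwalk_iff_nth:
  "vwalk p D \<longleftrightarrow>
     p \<noteq> [] \<and> set p \<subseteq> verts D \<and> (\<forall>i. Suc i < length p \<longrightarrow> p ! i \<rightarrow>\<^bsub>D\<^esub> p ! Suc i)"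
proof -
  have "set (vwalk_arcs p) = {(p ! i, p ! Suc i) |i. Suc i < length p}"
  proof (induction p rule: vwalk_arcs.induct)
    case (3 x y xs)
    have "{((x # y # xs) ! i, (x # y # xs) ! Suc i) |i. Suc i < length (x # y # xs)} =
        insert (x, y) {((y # xs) ! i, (y # xs) ! Suc i) |i. Suc i < length (y # xs)}"
      (is "?L = insert _ ?R")
    proof
      show "?L \<subseteq> insert (x, y) ?R"
      proof
        fix e assume "e \<in> ?L"
        then obtain i where i: "e = ((x # y # xs) ! i, (x # y # xs) ! Suc i)"
            "Suc i < length (x # y # xs)" by blast
        show "e \<in> insert (x, y) ?R"
          using i by (cases i) auto
      qed
      show "insert (x, y) ?R \<subseteq> ?L"
      proof
        fix e assume "e \<in> insert (x, y) ?R"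
        then consider "e = (x, y)"
          | i where "e = ((y # xs) ! i, (y # xs) ! Suc i)" "Suc i < length (y # xs)" by blast
        then show "e \<in> ?L"
        proof cases
          case 1
          then show ?thesis by (auto intro!: exI[of _ 0])
        next
          case 2
          then show ?thesis by (auto intro!: exI[of _ "Suc i"])
        qed
      qed
    qed
    then show ?case using 3 by simp
  qed auto
  then show ?thesis by (auto simp: vwalk_def)
qed

lemma path_from_to_iff:
  "path_from_to D {x} {y} p \<longleftrightarrow> vwalk p D \<and> hd p = x \<and> last p = y"
  by (simp add: path_from_to_def)

lemma path_from_to_segment:
  assumes "vwalk p D" "i \<le> j" "j < length p"
  shows "path_from_to D {p ! i} {p ! j} (drop i (take (Suc j) p))"
  using assms
  by (auto simp: path_from_to_iff vwalk_iff_nth hd_drop_conv_nth last_drop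
      last_conv_nth dest!: in_set_dropD in_set_takeD)

lemma path_from_to_ray_segment:
  assumes "R \<in> rays D" "i \<le> j"
  shows "path_from_to D {R i} {R j} (map R [i..<Suc j])"
  using assms unfolding path_from_to_iff vwalk_iff_nth rays_def
  by (auto simp: hd_map last_map nth_append simp del: upt_Suc)

lemma path_from_to_anti_ray_segment:
  assumes "R \<in> anti_rays D" "i \<le> j"
  shows "path_from_to D {R j} {R i} (rev (map R [i..<Suc j]))"
proof -
  have "rev (map R [i..<Suc j]) ! k \<rightarrow>\<^bsub>D\<^esub> rev (map R [i..<Suc j]) ! Suc k"
    if "Suc k < Suc j - i" for k
  proof -
    have "rev (map R [i..<Suc j]) ! k = R (Suc (j - Suc k))"
      "rev (map R [i..<Suc j]) ! Suc k = R (j - Suc k)"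
      using that assms(2) by (auto simp: rev_nth simp del: upt_Suc intro!: arg_cong[of _ _ R])
    then show ?thesis using assms(1) by (simp add: anti_rays_def)
  qed
  moreover have "R ` {i..<Suc j} \<subseteq> verts D" using assms(1) by (auto simp: anti_rays_def)
  ultimately show ?thesis using assms(2)
    by (simp add: path_from_to_iff vwalk_iff_nth hd_rev last_rev hd_map last_map del: upt_Suc)
qed

lemma path_from_to_join:
  assumes "path_from_to D {x} {y} p" "path_from_to D {y} {z} q"
  shows "path_from_to D {x} {z} (p \<oplus> q)" "set (p \<oplus> q) \<subseteq> set p \<union> set q"
    "vwalk_length (p \<oplus> q) = vwalk_length p + vwalk_length q"
proof -
  have j: "joinable p q"
    using assms by (auto simp: path_from_to_def vwalk_def)
  show "path_from_to D {x} {z} (p \<oplus> q)"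
    using assms j
    by (auto simp: path_from_to_def vwalk_join_hd vwalk_join_last vwalk_joinI_vwalk)
  show "set (p \<oplus> q) \<subseteq> set p \<union> set q"
    by (cases q) (auto simp: vwalk_join_def)
  show "vwalk_length (p \<oplus> q) = vwalk_length p + vwalk_length q"
    using j by (rule vwalk_join_vwalk_length)
qed

lemma ddist_le:
  assumes "path_from_to D {x} {y} p"
  shows "ddist D x y \<le> enat (vwalk_length p)"
  unfolding ddist_def using assms by (intro INF_lower) auto

lemma geodesic_exists:
  assumes "ddist D x y \<noteq> \<infinity>"
  obtains p where "geodesic D p" "hd p = x" "last p = y"
proof -
  define A where "A = (\<lambda>p. enat (vwalk_length p)) ` {p. path_from_to D {x} {y} p}"
  have d: "ddist D x y = Inf A" by (simp add: ddist_def A_def)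
  with assms have "A \<noteq> {}" by (auto simp: Inf_enat_def)
  then have "Inf A \<in> A" by (auto simp: Inf_enat_def intro: LeastI)
  then show ?thesis using that d
    by (auto simp: A_def path_from_to_iff geodesic_def)
qed

lemma geodesic_path: "geodesic D p \<Longrightarrow> path_from_to D {hd p} {last p} p"
  by (simp add: geodesic_def path_from_to_iff)

lemma ddist_finite_iff: "ddist D x y \<noteq> \<infinity> \<longleftrightarrow> (\<exists>p. path_from_to D {x} {y} p)"
proof
  assume "ddist D x y \<noteq> \<infinity>"
  then obtain p where "geodesic D p" "hd p = x" "last p = y" by (rule geodesic_exists)
  then show "\<exists>p. path_from_to D {x} {y} p" using geodesic_path by metis
next
  assume "\<exists>p. path_from_to D {x} {y} p"
  then show "ddist D x y \<noteq> \<infinity>" using ddist_le by (metis enat_ord_simps(5) infinity_ileE)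
qed

lemma ddist_finite_verts:
  assumes "ddist D x y \<noteq> \<infinity>"
  shows "x \<in> verts D" "y \<in> verts D"
  using assms unfolding ddist_finite_iff path_from_to_def vwalk_def by auto

lemma ddist_triangle: "ddist D x z \<le> ddist D x y + ddist D y z"
proof (cases "ddist D x y = \<infinity> \<or> ddist D y z = \<infinity>")
  case False
  then obtain p q where p: "geodesic D p" "hd p = x" "last p = y"
    and q: "geodesic D q" "hd q = y" "last q = z"
    by (metis geodesic_exists)
  then have "path_from_to D {x} {y} p" "path_from_to D {y} {z} q"
    using geodesic_path by metis+
  from path_from_to_join(1,3)[OF this] show ?thesis
    using ddist_le p q by (metis geodesic_def plus_enat_simps(1))
qed auto

lemma ddist_finite_trans:
  "ddist D x y \<noteq> \<infinity> \<Longrightarrow> ddist D y z \<noteq> \<infinity> \<Longrightarrow> ddist D x z \<noteq> \<infinity>"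
  using ddist_triangle[of D x z y] by (metis enat_ord_simps(5) plus_eq_infty_iff_enat)

lemma ddist_self: "x \<in> verts D \<Longrightarrow> ddist D x x = 0"
  using ddist_le[of D x x "[x]"] by (auto simp: path_from_to_iff simp flip: zero_enat_def)

lemma ddist_arc:
  assumes "x \<rightarrow>\<^bsub>D\<^esub> y" "x \<in> verts D" "y \<in> verts D"
  shows "ddist D x y \<le> 1"
  using ddist_le[of D x y "[x, y]"] assms by (auto simp: path_from_to_iff vwalk_def one_enat_def)

lemma path_visits:
  assumes "path_from_to D {x} {y} p" "v \<in> set p"
  shows "ddist D x v \<le> enat (vwalk_length p)" "ddist D v y \<le> enat (vwalk_length p)"
proof -
  obtain k where k: "k < length p" "p ! k = v" using assms(2) by (auto simp: in_set_conv_nth)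
  have p: "vwalk p D" "hd p = x" "last p = y" "p \<noteq> []"
    using assms(1) by (auto simp: path_from_to_iff vwalk_def)
  then have xy: "x = p ! 0" "y = p ! (length p - 1)" by (auto simp: hd_conv_nth last_conv_nth)
  have "ddist D x v \<le> enat k"
    using ddist_le[OF path_from_to_segment[OF p(1), of 0 k]] k xy by simp
  then show "ddist D x v \<le> enat (vwalk_length p)"
    using k by (auto elim: order_trans)
  have "ddist D v y \<le> enat (length p - 1 - k)"
    using ddist_le[OF path_from_to_segment[OF p(1), of k "length p - 1"]] k xy by simp
  then show "ddist D v y \<le> enat (vwalk_length p)"
    by (auto elim: order_trans)
qed

lemma path_visits_finite:
  assumes "path_from_to D {x} {y} p" "v \<in> set p"
  shows "ddist D x v \<noteq> \<infinity>" "ddist D v y \<noteq> \<infinity>"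
  using path_visits[OF assms] by (metis infinity_ileE)+

lemma geodesic_ddist_nth:
  assumes "geodesic D p" "i \<le> j" "j < length p"
  shows "ddist D (p ! i) (p ! j) = enat (j - i)"
proof -
  have p: "vwalk p D" "p \<noteq> []" using assms(1) by (auto simp: geodesic_def vwalk_def)
  let ?n = "length p - 1"
  have le: "ddist D (p ! a) (p ! b) \<le> enat (b - a)" if "a \<le> b" "b < length p" for a b
    using ddist_le[OF path_from_to_segment[OF p(1) that]] that by simp
  have "enat ?n = ddist D (p ! 0) (p ! ?n)"
    using assms(1) p(2) by (simp add: geodesic_def hd_conv_nth last_conv_nth)
  also have "\<dots> \<le> ddist D (p ! 0) (p ! i) + (ddist D (p ! i) (p ! j) + ddist D (p ! j) (p ! ?n))"
    using ddist_triangle by (meson add_left_mono order_trans)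
  finally have "enat ?n \<le> \<dots>" .
  moreover have j: "j \<le> ?n" "?n < length p" using assms(3) by auto
  moreover obtain a where "ddist D (p ! 0) (p ! i) = enat a" "a \<le> i"
    using le[of 0 i] assms by (cases "ddist D (p ! 0) (p ! i)") auto
  moreover obtain b where "ddist D (p ! i) (p ! j) = enat b" "b \<le> j - i"
    using le[of i j] assms by (cases "ddist D (p ! i) (p ! j)") auto
  moreover obtain c where "ddist D (p ! j) (p ! ?n) = enat c" "c \<le> ?n - j"
    using le[OF j] by (cases "ddist D (p ! j) (p ! ?n)") auto
  ultimately have "?n \<le> a + (b + c)" "ddist D (p ! i) (p ! j) = enat b" "b \<le> j - i"
      "a \<le> i" "c \<le> ?n - j"
    by simp_all
  then show ?thesis using assms by simp
qed

section \<open>Reversing all arcs\<close>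

definition reversal :: "('a,'b) pre_digraph \<Rightarrow> ('a,'b) pre_digraph" where
  "reversal D = D\<lparr>tail := head D, head := tail D\<rparr>"

lemma verts_reversal [simp]: "verts (reversal D) = verts D"
  by (simp add: reversal_def)

lemma arcs_ends_reversal [simp]: "x \<rightarrow>\<^bsub>reversal D\<^esub> y \<longleftrightarrow> y \<rightarrow>\<^bsub>D\<^esub> x"
  by (auto simp: arcs_ends_conv reversal_def)

lemma vwalk_reversal [simp]: "vwalk p (reversal D) \<longleftrightarrow> vwalk (rev p) D"
  unfolding vwalk_def by (auto simp: set_vwalk_arcs_rev)

lemma path_from_to_reversal: "path_from_to (reversal D) X Y p \<longleftrightarrow> path_from_to D Y X (rev p)"
  by (auto simp: path_from_to_def hd_rev last_rev)

lemma ddist_reversal [simp]: "ddist (reversal D) x y = ddist D y x"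
proof -
  have "{p. path_from_to (reversal D) {x} {y} p} = rev ` {p. path_from_to D {y} {x} p}"
  proof -
    have "p \<in> rev ` {p. path_from_to D {y} {x} p}" if "path_from_to D {y} {x} (rev p)" for p
      using that by (intro image_eqI[of _ _ "rev p"]) auto
    then show ?thesis by (auto simp: path_from_to_reversal)
  qed
  then show ?thesis by (simp add: ddist_def image_image)
qed

lemma geodesic_reversal: "geodesic (reversal D) p \<longleftrightarrow> geodesic D (rev p)"
  by (simp add: geodesic_def hd_rev last_rev)

lemma out_ball_reversal: "out_ball (reversal D) r x = in_ball D r x"
  and in_ball_reversal: "in_ball (reversal D) r x = out_ball D r x"
  by (simp_all add: out_ball_def in_ball_def)

lemma B1_reversal: "B2 D \<Longrightarrow> B1 (reversal D)"
  unfolding B1_def B2_def out_ball_reversal verts_reversal ddist_reversal by metis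

lemma finite_out_degrees_reversal: "finite_out_degrees (reversal D) \<longleftrightarrow> finite_in_degrees D"
  by (simp add: finite_out_degrees_def finite_in_degrees_def)

lemma rays_reversal: "rays (reversal D) = anti_rays D"
  by (simp add: rays_def anti_rays_def)

lemma geodesic_rays_reversal: "geodesic_rays (reversal D) = geodesic_anti_rays D"
  by (simp add: geodesic_rays_def geodesic_anti_rays_def rays_reversal geodesic_reversal
      del: upt_Suc)

lemma end_le_reversal: "end_le (reversal D) R1 R2 \<Longrightarrow> end_le D R2 R1"
proof -
  assume "end_le (reversal D) R1 R2"
  then obtain \<P> where \<P>: "infinite \<P>" "\<And>p. p \<in> \<P> \<Longrightarrow> path_from_to D (range R2) (range R1) (rev p)"
      "pairwise (\<lambda>p q. set p \<inter> set q = {}) \<P>"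
    unfolding end_le_def path_from_to_reversal by blast
  have "infinite (rev ` \<P>)" using \<P>(1) by (simp add: finite_image_iff)
  moreover have "pairwise (\<lambda>p q. set p \<inter> set q = {}) (rev ` \<P>)"
    using \<P>(3) by (auto simp: pairwise_def)
  ultimately show ?thesis unfolding end_le_def using \<P>(2) by blast
qed

lemma end_equiv_reversal: "end_equiv (reversal D) R1 R2 \<Longrightarrow> end_equiv D R1 R2"
  by (simp add: end_equiv_def end_le_reversal)

lemma thinD:
  assumes "thin D \<delta> A B C" "{#P, Q, R#} = {#A, B, C#}"
    "hd P \<in> {hd Q, last Q}" "last P \<in> {hd R, last R}"
  shows "set P \<subseteq> (\<Union>q \<in> set Q. out_ball D \<delta> q) \<union> (\<Union>q \<in> set R. in_ball D \<delta> q)"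
  using assms(1)[unfolded thin_def, THEN spec, THEN spec, THEN spec, THEN mp, THEN mp, THEN mp,
      OF assms(2-4)] .

text \<open>Reversal turns the labelling \<open>P, Q, R\<close> of the sides of a triangle into the admissible
  labelling \<open>P, R, Q\<close> and exchanges out-balls with in-balls, so that thinness is symmetric.\<close>

lemma hyperbolic_reversal:
  assumes "hyperbolic D"
  shows "hyperbolic (reversal D)"
proof -
  obtain \<delta> where \<delta>: "\<delta> \<ge> 0"
    "\<And>x y z A B C. geodesic_triangle D x y z A B C \<Longrightarrow> thin D \<delta> A B C"
    using assms by (auto simp: hyperbolic_def)
  have "thin (reversal D) \<delta> A B C" if "geodesic_triangle (reversal D) x y z A B C" for x y z A B C
    unfolding thin_def
  proof (intro allI impI)
    fix P Q R
    assume lab: "{#P, Q, R#} = {#A, B, C#}"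
      and hd: "hd P \<in> {hd Q, last Q}" and last: "last P \<in> {hd R, last R}"
    have "geodesic_triangle D x y z (rev A) (rev B) (rev C)"
      using that by (auto simp: geodesic_triangle_def geodesic_between_def geodesic_reversal
          hd_rev last_rev)
    then have "thin D \<delta> (rev A) (rev B) (rev C)" by (rule \<delta>)
    moreover have "{#rev P, rev R, rev Q#} = {#rev A, rev B, rev C#}"
      using arg_cong[OF lab, of "image_mset rev"] by (simp add: add_mset_commute)
    moreover have "hd (rev P) \<in> {hd (rev R), last (rev R)}"
      "last (rev P) \<in> {hd (rev Q), last (rev Q)}"
      using hd last by (auto simp: hd_rev last_rev)
    ultimately have "set (rev P) \<subseteq>
        (\<Union>q \<in> set (rev R). out_ball D \<delta> q) \<union> (\<Union>q \<in> set (rev Q). in_ball D \<delta> q)"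
      by (rule thinD)
    then show "set P \<subseteq> (\<Union>q \<in> set Q. out_ball (reversal D) \<delta> q) \<union>
        (\<Union>q \<in> set R. in_ball (reversal D) \<delta> q)"
      by (simp add: out_ball_reversal in_ball_reversal Un_commute)
  qed
  then show ?thesis using \<delta>(1) by (auto simp: hyperbolic_def)
qed

section \<open>The preorder on rays and anti-rays\<close>

definition reach_avoiding :: "('a,'b) pre_digraph \<Rightarrow> 'a set \<Rightarrow> 'a \<Rightarrow> 'a \<Rightarrow> bool" where
  "reach_avoiding D U x y \<longleftrightarrow> (\<exists>p. path_from_to D {x} {y} p \<and> set p \<inter> U = {})"

lemma reach_avoiding_trans:
  assumes "reach_avoiding D U x y" "reach_avoiding D U y z"
  shows "reach_avoiding D U x z"
proof -
  obtain p q where "path_from_to D {x} {y} p" "path_from_to D {y} {z} q"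
      "set p \<inter> U = {}" "set q \<inter> U = {}"
    using assms by (auto simp: reach_avoiding_def)
  with path_from_to_join(1,2)[OF this(1,2)] show ?thesis
    unfolding reach_avoiding_def by blast
qed

lemma reach_avoiding_mono: "reach_avoiding D W x y \<Longrightarrow> U \<subseteq> W \<Longrightarrow> reach_avoiding D U x y"
  unfolding reach_avoiding_def by blast

lemma reach_avoiding_ddist: "reach_avoiding D U x y \<Longrightarrow> ddist D x y \<noteq> \<infinity>"
  unfolding reach_avoiding_def ddist_finite_iff by blast

lemma reach_avoiding_ends:
  assumes "reach_avoiding D U x y"
  shows "x \<notin> U" "y \<notin> U"
proof -
  obtain p where p: "path_from_to D {x} {y} p" "set p \<inter> U = {}"
    using assms by (auto simp: reach_avoiding_def)
  then have "p \<noteq> []" by (auto simp: path_from_to_def vwalk_def)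
  then have "hd p \<in> set p" "last p \<in> set p" by auto
  then show "x \<notin> U" "y \<notin> U" using p by (auto simp: path_from_to_iff)
qed

text \<open>Pairwise disjoint paths can be chosen greedily, each one avoiding the finitely many
  vertices of its predecessors; conversely, a finite set meets only finitely many members of a
  disjoint family. All later arguments about \<open>end_le\<close> use this form of the relation.\<close>

lemma end_le_iff:
  "end_le D R1 R2 \<longleftrightarrow> (\<forall>U. finite U \<longrightarrow> (\<exists>i j. reach_avoiding D U (R1 i) (R2 j)))"
proof
  assume "end_le D R1 R2"
  then obtain \<P> where \<P>: "infinite \<P>" "\<And>p. p \<in> \<P> \<Longrightarrow> path_from_to D (range R1) (range R2) p"
      "pairwise (\<lambda>p q. set p \<inter> set q = {}) \<P>"
    unfolding end_le_def by blast
  show "\<forall>U. finite U \<longrightarrow> (\<exists>i j. reach_avoiding D U (R1 i) (R2 j))"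
  proof (intro allI impI)
    fix U :: "'a set" assume U: "finite U"
    define hit where "hit p = (SOME u. u \<in> set p \<inter> U)" for p
    have hit: "hit p \<in> set p \<inter> U" if "set p \<inter> U \<noteq> {}" for p
      unfolding hit_def using that by (metis ex_in_conv someI_ex)
    have "inj_on hit {p \<in> \<P>. set p \<inter> U \<noteq> {}}"
    proof (rule inj_onI)
      fix p q assume pq: "p \<in> {p \<in> \<P>. set p \<inter> U \<noteq> {}}" "q \<in> {p \<in> \<P>. set p \<inter> U \<noteq> {}}"
        and eq: "hit p = hit q"
      then have "hit p \<in> set p" "hit q \<in> set q" using hit[of p] hit[of q] by auto
      then have "set p \<inter> set q \<noteq> {}" using eq by auto
      then show "p = q" using \<P>(3) pq unfolding pairwise_def by blast
    qed
    moreover have "hit ` {p \<in> \<P>. set p \<inter> U \<noteq> {}} \<subseteq> U" using hit by blast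
    ultimately have "finite {p \<in> \<P>. set p \<inter> U \<noteq> {}}" using U by (rule inj_on_finite)
    then have "infinite (\<P> - {p \<in> \<P>. set p \<inter> U \<noteq> {}})" using \<P>(1) by simp
    then obtain p where "p \<in> \<P>" "set p \<inter> U = {}" by (auto dest: infinite_imp_nonempty)
    then show "\<exists>i j. reach_avoiding D U (R1 i) (R2 j)"
      using \<P>(2)[of p] unfolding reach_avoiding_def path_from_to_def by blast
  qed
next
  assume av: "\<forall>U. finite U \<longrightarrow> (\<exists>i j. reach_avoiding D U (R1 i) (R2 j))"
  have next_path: "\<exists>p. path_from_to D (range R1) (range R2) p \<and> set p \<inter> U = {}"
    if "finite U" for U
    using av that unfolding reach_avoiding_def path_from_to_def by blast
  \<comment> \<open>The set component of the state collects the vertices used so far.\<close>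
  define ok where "ok s \<longleftrightarrow> finite (snd s) \<and> path_from_to D (range R1) (range R2) (fst s) \<and>
      set (fst s) \<subseteq> snd s" for s :: "'a list \<times> 'a set"
  obtain s where s: "\<And>n. ok (s n)"
      "\<And>n. snd (s n) \<subseteq> snd (s (Suc n)) \<and> set (fst (s (Suc n))) \<inter> snd (s n) = {}"
  proof (atomize_elim, rule dependent_nat_choice[where P = "\<lambda>_. ok", simplified all_conj_distrib])
    obtain p where "path_from_to D (range R1) (range R2) p"
      using next_path[of "{}"] by auto
    then show "\<exists>s. ok s" by (intro exI[of _ "(p, set p)"]) (simp add: ok_def)
  next
    fix t and n :: nat assume t: "ok t"
    obtain p where "path_from_to D (range R1) (range R2) p" "set p \<inter> snd t = {}"
      using next_path[of "snd t"] t by (auto simp: ok_def)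
    then show "\<exists>t'. ok t' \<and> snd t \<subseteq> snd t' \<and> set (fst t') \<inter> snd t = {}"
      using t by (intro exI[of _ "(p, snd t \<union> set p)"]) (auto simp: ok_def)
  qed
  have mono: "snd (s m) \<subseteq> snd (s n)" if "m \<le> n" for m n
    using lift_Suc_mono_le[of "\<lambda>n. snd (s n)", OF _ that] s(2) by blast
  have disj: "set (fst (s m)) \<inter> set (fst (s n)) = {}" if "m < n" for m n
  proof -
    from that obtain k where k: "n = Suc k" "m \<le> k" by (cases n) auto
    have "set (fst (s m)) \<subseteq> snd (s k)" using mono[OF k(2)] s(1)[of m] by (auto simp: ok_def)
    then show ?thesis using s(2)[of k] k by auto
  qed
  have ne: "set (fst (s n)) \<noteq> {}" for n
    using s(1)[of n] by (auto simp: ok_def path_from_to_def vwalk_def)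
  have disj': "set (fst (s m)) \<inter> set (fst (s n)) = {}" if "m \<noteq> n" for m n
    using disj[of m n] disj[of n m] that by (cases "m < n") auto
  have "inj (\<lambda>n. fst (s n))"
    using disj' ne by (intro injI) (metis inf.idem)
  then have "infinite (range (\<lambda>n. fst (s n)))" by (rule range_inj_infinite)
  moreover have "pairwise (\<lambda>p q. set p \<inter> set q = {}) (range (\<lambda>n. fst (s n)))"
  proof (rule pairwiseI, clarify)
    fix m n assume "fst (s m) \<noteq> fst (s n)"
    then have "m \<noteq> n" by blast
    then show "set (fst (s m)) \<inter> set (fst (s n)) = {}" by (rule disj')
  qed
  moreover have "path_from_to D (range R1) (range R2) p" if "p \<in> range (\<lambda>n. fst (s n))" for p
    using that s(1) by (auto simp: ok_def)
  ultimately show "end_le D R1 R2" unfolding end_le_def by blast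
qed

text \<open>The two paths are linked along \<open>R2\<close> beyond the finite set that is to be avoided. The link
  has to follow the orientation of \<open>R2\<close>: for a ray the path leaving \<open>R2\<close> is chosen last, for an
  anti-ray the path arriving at \<open>R2\<close> is.\<close>

lemma end_le_trans:
  assumes R2: "R2 \<in> rays D \<union> anti_rays D"
    and le: "end_le D R1 R2" "end_le D R2 R3"
  shows "end_le D R1 R3"
  unfolding end_le_iff
proof (intro allI impI)
  fix U :: "'a set" assume U: "finite U"
  have "inj R2" using R2 by (auto simp: rays_def anti_rays_def)
  with U have "finite {i. R2 i \<in> U}" using finite_vimageI[OF U] by (simp add: vimage_def)
  then obtain K where K: "\<And>i. i > K \<Longrightarrow> R2 i \<notin> U"
    by (metis (mono_tags, lifting) finite_nat_set_iff_bounded_le mem_Collect_eq not_le)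
  have beyond: "n < j" if "reach_avoiding D (U \<union> R2 ` {..n}) x (R2 j) \<or>
      reach_avoiding D (U \<union> R2 ` {..n}) (R2 j) x" for n j x
    using reach_avoiding_ends that by (metis UnI2 atMost_iff imageI leI)
  show "\<exists>i j. reach_avoiding D U (R1 i) (R3 j)"
  proof (cases "R2 \<in> rays D")
    case True
    obtain a i where a: "reach_avoiding D (U \<union> R2 ` {..K}) (R1 a) (R2 i)"
      using le(1) U unfolding end_le_iff by (metis finite_UnI finite_imageI finite_atMost)
    obtain j b where b: "reach_avoiding D (U \<union> R2 ` {..i}) (R2 j) (R3 b)"
      using le(2) U unfolding end_le_iff by (metis finite_UnI finite_imageI finite_atMost)
    have "K < i" "i < j" using a b beyond by blast+
    then have "reach_avoiding D U (R2 i) (R2 j)"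
      using path_from_to_ray_segment[OF True, of i j] K unfolding reach_avoiding_def
      by (intro exI[of _ "map R2 [i..<Suc j]"]) (auto simp del: upt_Suc)
    then show ?thesis
      using a b by (meson Un_upper1 reach_avoiding_mono reach_avoiding_trans)
  next
    case False
    then have anti: "R2 \<in> anti_rays D" using R2 by simp
    obtain i b where b: "reach_avoiding D (U \<union> R2 ` {..K}) (R2 i) (R3 b)"
      using le(2) U unfolding end_le_iff by (metis finite_UnI finite_imageI finite_atMost)
    obtain a j where a: "reach_avoiding D (U \<union> R2 ` {..i}) (R1 a) (R2 j)"
      using le(1) U unfolding end_le_iff by (metis finite_UnI finite_imageI finite_atMost)
    have "K < i" "i < j" using a b beyond by blast+
    then have "reach_avoiding D U (R2 j) (R2 i)"
      using path_from_to_anti_ray_segment[OF anti, of i j] K unfolding reach_avoiding_def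
      by (intro exI[of _ "rev (map R2 [i..<Suc j])"]) (auto simp del: upt_Suc)
    then show ?thesis
      using a b by (meson Un_upper1 reach_avoiding_mono reach_avoiding_trans)
  qed
qed

lemma end_equiv_trans:
  assumes "R2 \<in> rays D \<union> anti_rays D" "end_equiv D R1 R2" "end_equiv D R2 R3"
  shows "end_equiv D R1 R3"
  using assms end_le_trans unfolding end_equiv_def by metis

section \<open>Equivalent geodesic rays and anti-rays belong to the same end\<close>

lemma finite_enat_bound:
  fixes f :: "'c \<Rightarrow> enat"
  assumes "finite W" "\<And>w. w \<in> W \<Longrightarrow> f w \<noteq> \<infinity>"
  obtains n where "\<And>w. w \<in> W \<Longrightarrow> f w \<le> enat n"
proof
  fix w assume w: "w \<in> W"
  then obtain k where k: "f w = enat k" using assms(2)[OF w] by (cases "f w") auto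
  have "the_enat (f w) \<le> Max ((\<lambda>w. the_enat (f w)) ` W)"
    using w assms(1) by (intro Max_ge) auto
  then show "f w \<le> enat (Max ((\<lambda>w. the_enat (f w)) ` W))" using k by simp
qed

lemma out_ball_nat: "v \<in> out_ball D (real n) x \<longleftrightarrow> v \<in> verts D \<and> ddist D x v \<le> enat n"
  by (cases "ddist D x v") (auto simp: out_ball_def)

lemma out_ball_ddist: "v \<in> out_ball D r x \<Longrightarrow> ddist D x v \<le> enat (nat \<lceil>r\<rceil>)"
proof (cases "ddist D x v")
  case (enat n)
  assume "v \<in> out_ball D r x"
  then have "real n \<le> r" using enat by (simp add: out_ball_def)
  then show ?thesis using enat by simp linarith
qed (simp add: out_ball_def)

lemma in_ball_ddist: "v \<in> in_ball D r x \<Longrightarrow> ddist D v x \<le> enat (nat \<lceil>r\<rceil>)"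
  using out_ball_ddist[of v "reversal D"] by (simp add: out_ball_reversal)

lemma ray_forward_finite:
  assumes "R \<in> rays D" "i \<le> j"
  shows "ddist D (R i) (R j) \<noteq> \<infinity>"
  using path_from_to_ray_segment[OF assms] unfolding ddist_finite_iff by blast

lemma anti_ray_forward_finite:
  assumes "R \<in> anti_rays D" "i \<le> j"
  shows "ddist D (R j) (R i) \<noteq> \<infinity>"
  using path_from_to_anti_ray_segment[OF assms] unfolding ddist_finite_iff by blast

text \<open>A path from \<open>R1\<close> to \<open>R2\<close> can only meet those vertices of a finite set that are reachable
  from \<open>R1\<close>. One vertex of \<open>R1\<close> reaches all of these, be it the first vertex of a ray or a late
  vertex of an anti-ray, so they lie in a single out-ball.\<close>

lemma geo_le_imp_end_le:
  assumes R1: "R1 \<in> rays D \<union> anti_rays D" and le: "geo_le D R1 R2"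
  shows "end_le D R1 R2"
  unfolding end_le_iff
proof (intro allI impI)
  fix U :: "'a set" assume U: "finite U"
  define W where "W = {u \<in> U. \<exists>i. ddist D (R1 i) u \<noteq> \<infinity>}"
  have W: "finite W" using U by (simp add: W_def)
  obtain k where k: "\<And>u. u \<in> W \<Longrightarrow> ddist D (R1 k) u \<noteq> \<infinity>"
  proof (cases "R1 \<in> rays D")
    case True
    have "ddist D (R1 0) u \<noteq> \<infinity>" if "u \<in> W" for u
    proof -
      from that obtain i where "ddist D (R1 i) u \<noteq> \<infinity>" unfolding W_def by blast
      then show ?thesis by (rule ddist_finite_trans[OF ray_forward_finite[OF True le0]])
    qed
    then show ?thesis by (rule that)
  next
    case False
    have "\<forall>u\<in>W. \<exists>i. ddist D (R1 i) u \<noteq> \<infinity>" unfolding W_def by blast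
    from bchoice[OF this] obtain i where i: "\<And>u. u \<in> W \<Longrightarrow> ddist D (R1 (i u)) u \<noteq> \<infinity>"
      by blast
    have anti: "R1 \<in> anti_rays D" using False R1 by simp
    have "ddist D (R1 (Max (i ` W))) u \<noteq> \<infinity>" if "u \<in> W" for u
    proof (rule ddist_finite_trans[OF anti_ray_forward_finite[OF anti] i[OF that]])
      show "i u \<le> Max (i ` W)" using W that by (intro Max_ge) auto
    qed
    then show ?thesis by (rule that)
  qed
  obtain r where r: "\<And>u. u \<in> W \<Longrightarrow> ddist D (R1 k) u \<le> enat r"
    using finite_enat_bound[OF W, of "ddist D (R1 k)"] k by blast
  have "R1 k \<in> verts D" using R1 by (auto simp: rays_def anti_rays_def)
  then obtain p where p: "path_from_to D (range R1) (range R2) p"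
      "set p \<inter> out_ball D (real r) (R1 k) = {}"
    using le unfolding geo_le_def by (metis Int_Un_distrib Un_empty of_nat_0_le_iff)
  then obtain i j where ij: "path_from_to D {R1 i} {R2 j} p" unfolding path_from_to_def by blast
  have "W \<subseteq> out_ball D (real r) (R1 k)"
  proof
    fix u assume u: "u \<in> W"
    show "u \<in> out_ball D (real r) (R1 k)"
      using r[OF u] ddist_finite_verts(2)[OF k[OF u]] by (simp add: out_ball_nat)
  qed
  moreover have "u \<in> W" if "u \<in> U" "u \<in> set p" for u
    using that path_visits_finite(1)[OF ij that(2)] unfolding W_def by blast
  ultimately have "set p \<inter> U = {}" using p(2) by blast
  then show "\<exists>i j. reach_avoiding D U (R1 i) (R2 j)"
    using ij unfolding reach_avoiding_def by blast
qed

section \<open>Limits of geodesics\<close>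

text \<open>Koenig's lemma, as sequential compactness of a product of finite sets.\<close>

lemma koenig_limit:
  fixes a :: "nat \<Rightarrow> nat \<Rightarrow> 'c"
  assumes "\<And>k. finite (F k)" "\<And>m k. a m k \<in> F k"
  obtains g where "\<And>k. infinite {m. \<forall>i\<le>k. a m i = g i}"
proof -
  define P where "P k S \<longleftrightarrow> infinite S \<and> (\<exists>v. \<forall>m\<in>S. a m k = v)" for k and S :: "nat set"
  have refine: "\<exists>T. P k T \<and> T \<subseteq> S" if S: "infinite S" for k S
  proof -
    have "finite ((\<lambda>m. a m k) ` S)"
      using assms by (intro finite_subset[OF _ assms(1)[of k]]) auto
    from pigeonhole_infinite[OF S this] obtain m0 where "infinite {m \<in> S. a m k = a m0 k}"
      by blast
    then show ?thesis by (intro exI[of _ "{m \<in> S. a m k = a m0 k}"]) (auto simp: P_def)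
  qed
  have "\<exists>S. \<forall>n. P n (S n) \<and> S (Suc n) \<subseteq> S n"
  proof (rule dependent_nat_choice)
    show "\<exists>S. P 0 S" using refine[of UNIV] by blast
    show "\<exists>T. P (Suc n) T \<and> T \<subseteq> S" if "P n S" for S n
      using refine[of S] that unfolding P_def by blast
  qed
  then obtain S where S: "\<And>n. P n (S n)" "\<And>n. S (Suc n) \<subseteq> S n" by blast
  then obtain g where g: "\<And>n m. m \<in> S n \<Longrightarrow> a m n = g n"
    unfolding P_def by metis
  have "infinite {m. \<forall>i\<le>k. a m i = g i}" for k
  proof (rule infinite_super)
    show "S k \<subseteq> {m. \<forall>i\<le>k. a m i = g i}"
      using lift_Suc_antimono_le[of S, OF S(2)] g by blast
    show "infinite (S k)" using S(1)[of k] by (simp add: P_def)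
  qed
  then show ?thesis by (rule that)
qed

lemma finite_ddist_le:
  assumes "finite_out_degrees D"
  shows "finite {y. ddist D x y \<le> enat k}"
proof (induction k)
  case 0
  have "y = x" if "ddist D x y \<le> enat 0" for y
  proof -
    from that have d: "ddist D x y = enat 0" by (cases "ddist D x y") auto
    then have "ddist D x y \<noteq> \<infinity>" by simp
    then obtain p where p: "geodesic D p" "hd p = x" "last p = y" by (rule geodesic_exists)
    then have "length p = 1" using d by (auto simp: geodesic_def vwalk_def le_Suc_eq neq_Nil_conv)
    then show "y = x" using p by (auto simp: length_Suc_conv)
  qed
  then show ?case by (auto intro: finite_subset[of _ "{x}"])
next
  case (Suc k)
  let ?B = "{y. ddist D x y \<le> enat k}"
  have "y \<in> ?B \<union> (\<Union>z \<in> ?B \<inter> verts D. {y \<in> verts D. ddist D z y = 1})"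
    if "ddist D x y \<le> enat (Suc k)" for y
  proof (cases "ddist D x y \<le> enat k")
    case False
    then have d: "ddist D x y = enat (Suc k)" using that by (cases "ddist D x y") auto
    then have "ddist D x y \<noteq> \<infinity>" by simp
    then obtain p where p: "geodesic D p" "hd p = x" "last p = y" by (rule geodesic_exists)
    then have len: "length p = Suc (Suc k)" using d by (auto simp: geodesic_def)
    then have "p \<noteq> []" by auto
    then have xy: "x = p ! 0" "y = p ! Suc k" using p len by (auto simp: hd_conv_nth last_conv_nth)
    have "ddist D x (p ! k) = enat k" "ddist D (p ! k) y = 1"
      using geodesic_ddist_nth[OF p(1)] len xy by (auto simp: one_enat_def)
    moreover have "p ! k \<in> verts D" "y \<in> verts D"
      using p(1) len xy by (auto simp: geodesic_def vwalk_def)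
    ultimately show ?thesis by auto
  qed auto
  then have "{y. ddist D x y \<le> enat (Suc k)} \<subseteq>
      ?B \<union> (\<Union>z \<in> ?B \<inter> verts D. {y \<in> verts D. ddist D z y = 1})" by blast
  moreover have "finite (?B \<union> (\<Union>z \<in> ?B \<inter> verts D. {y \<in> verts D. ddist D z y = 1}))"
    using Suc assms by (auto simp: finite_out_degrees_def)
  ultimately show ?case by (rule finite_subset)
qed

lemma injective_escapes:
  assumes "finite_out_degrees D" "inj y"
  shows "finite {m::nat. ddist D x (y m) \<le> enat k}"
  using finite_vimageI[OF finite_ddist_le[OF assms(1), of x k] assms(2)] by (simp add: vimage_def)

text \<open>The conclusion provides infinitely many \<open>P m\<close> following \<open>G\<close> for each \<open>k\<close>, rather than one
  convergent subsequence, so that any finite number of further indices can still be excluded.\<close>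

lemma geodesic_limit:
  fixes P :: "nat \<Rightarrow> 'a list"
  assumes fin: "finite_out_degrees D"
    and P: "\<And>m. geodesic D (P m)" "\<And>m. hd (P m) = x" and inj: "inj (\<lambda>m. last (P m))"
  obtains G where "G \<in> geodesic_rays D"
    "\<And>k. infinite {m. k < length (P m) \<and> (\<forall>i\<le>k. P m ! i = G i)}"
proof -
  have ne: "P m \<noteq> []" for m using P(1) by (auto simp: geodesic_def vwalk_def)
  have start: "P m ! 0 = x" for m using P(2) ne by (simp add: flip: hd_conv_nth)
  have dist: "ddist D x (P m ! i) = enat i" if "i < length (P m)" for m i
    using geodesic_ddist_nth[OF P(1), of 0 i m] that start by simp
  have x: "x \<in> verts D" using P(1)[of 0] start[of 0] ne[of 0] nth_mem[of 0 "P 0"]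
    by (auto simp: geodesic_def vwalk_def)
  \<comment> \<open>Short geodesics are padded with \<open>x\<close>; only finitely many are shorter than a given bound.\<close>
  define a where "a m i = (if i < length (P m) then P m ! i else x)" for m i
  have a: "a m k \<in> {y. ddist D x y \<le> enat k}" for m k
    using dist[of k m] ddist_self[OF x] by (auto simp: a_def)
  obtain G where G: "\<And>k. infinite {m. \<forall>i\<le>k. a m i = G i}"
    using koenig_limit[of "\<lambda>k. {y. ddist D x y \<le> enat k}" a, OF finite_ddist_le[OF fin] a]
    by blast
  have long: "infinite {m. k < length (P m) \<and> (\<forall>i\<le>k. P m ! i = G i)}" for k
  proof -
    have "m \<in> {m. ddist D x (last (P m)) \<le> enat k}" if "\<not> k < length (P m)" for m
      using that dist[of "length (P m) - 1" m] ne[of m] by (auto simp: last_conv_nth)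
    then have "{m. \<forall>i\<le>k. a m i = G i} - {m. ddist D x (last (P m)) \<le> enat k}
        \<subseteq> {m. k < length (P m) \<and> (\<forall>i\<le>k. P m ! i = G i)}"
      by (auto simp: a_def)
    moreover have "infinite ({m. \<forall>i\<le>k. a m i = G i} - {m. ddist D x (last (P m)) \<le> enat k})"
      using G injective_escapes[OF fin inj] by (rule Diff_infinite_finite[rotated])
    ultimately show ?thesis by (rule infinite_super)
  qed
  have initial: "\<exists>m. k < length (P m) \<and> (\<forall>i\<le>k. P m ! i = G i)" for k
    using infinite_imp_nonempty[OF long[of k]] by blast
  have geo: "ddist D (G i) (G j) = enat (j - i)" if "i \<le> j" for i j
    using initial[of j] geodesic_ddist_nth[OF P(1) that] that by (metis order_refl)
  have ray: "G \<in> rays D"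
    unfolding rays_def
  proof (intro CollectI conjI allI)
    show "inj G"
    proof (rule linorder_injI)
      fix i j :: nat assume "i < j"
      then show "G i \<noteq> G j" using geo[of i j] geo[of i i] by auto
    qed
    show "range G \<subseteq> verts D"
    proof clarify
      fix i
      have "ddist D (G i) (G i) \<noteq> \<infinity>" using geo[of i i] by simp
      then show "G i \<in> verts D" by (rule ddist_finite_verts)
    qed
    show "G i \<rightarrow>\<^bsub>D\<^esub> G (Suc i)" for i
      using initial[of "Suc i"] P(1) unfolding geodesic_def vwalk_iff_nth
      by (metis le_Suc_eq order_refl)
  qed
  have "geodesic D (map G [m..<Suc n])" if "m \<le> n" for m n
    using path_from_to_ray_segment[OF ray that] geo[OF that] that
    by (auto simp: geodesic_def path_from_to_iff)
  with ray have "G \<in> geodesic_rays D" by (simp add: geodesic_rays_def del: upt_Suc)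
  then show ?thesis using long by (rule that)
qed

text \<open>A geodesic from \<open>x\<close> that follows \<open>G\<close> up to its \<open>k\<close>-th vertex continues at distance at
  least \<open>k\<close> from \<open>x\<close>. For large \<open>k\<close> its remainder avoids any given finite set.\<close>

lemma end_le_of_geodesic_limit:
  assumes P: "\<And>m. geodesic D (P m)" "\<And>m. hd (P m) = x"
    and lim: "\<And>k. infinite {m. k < length (P m) \<and> (\<forall>i\<le>k. P m ! i = G i)}"
  shows "end_le D G (\<lambda>m. last (P m))"
  unfolding end_le_iff
proof (intro allI impI)
  fix U :: "'a set" assume U: "finite U"
  obtain k where k: "\<And>u. u \<in> {u \<in> U. ddist D x u \<noteq> \<infinity>} \<Longrightarrow> ddist D x u \<le> enat k"
    using finite_enat_bound[of "{u \<in> U. ddist D x u \<noteq> \<infinity>}" "ddist D x"] U by auto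
  obtain m where m: "Suc k < length (P m)" "P m ! Suc k = G (Suc k)"
    using infinite_imp_nonempty[OF lim[of "Suc k"]] by auto
  have walk: "vwalk (P m) D" and ne: "P m \<noteq> []"
    using P(1)[of m] by (auto simp: geodesic_def vwalk_def)
  define q where "q = drop (Suc k) (take (Suc (length (P m) - 1)) (P m))"
  have q: "path_from_to D {G (Suc k)} {last (P m)} q"
    using path_from_to_segment[OF walk, of "Suc k" "length (P m) - 1"] m ne
    by (simp add: q_def last_conv_nth)
  have "u \<notin> U" if "u \<in> set q" for u
  proof -
    obtain i where i: "Suc k \<le> i" "i < length (P m)" "u = P m ! i"
    proof -
      from \<open>u \<in> set q\<close> obtain l where "l < length q" "u = q ! l"
        by (auto simp: in_set_conv_nth)
      with m ne show thesis
        by (intro that[of "Suc k + l"]) (auto simp: q_def)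
    qed
    have "ddist D x u = enat i"
      using geodesic_ddist_nth[OF P(1)[of m], of 0 i] i P(2)[of m] ne
      by (simp add: hd_conv_nth)
    with k[of u] i show "u \<notin> U" by auto
  qed
  then show "\<exists>i j. reach_avoiding D U (G i) (last (P j))"
    using q unfolding reach_avoiding_def by blast
qed

text \<open>Consider the thin triangle with corners \<open>x\<close>, \<open>last (P n)\<close> and \<open>last (P m)\<close>. Its third side
  \<open>Q\<close> leaves the finite out-neighbourhood of \<open>P n\<close> after a number of steps that does not depend
  on \<open>m\<close>. The vertex reached then is close to \<open>P m\<close>, and at bounded distance from \<open>x\<close>, where
  \<open>P m\<close> already agrees with \<open>G\<close>.\<close>

lemma reaches_geodesic_limit:
  fixes P :: "nat \<Rightarrow> 'a list"
  assumes fin: "finite_out_degrees D" and hyp: "hyperbolic D"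
    and P: "\<And>m. geodesic D (P m)" "\<And>m. hd (P m) = x" and inj: "inj (\<lambda>m. last (P m))"
    and lim: "\<And>k. infinite {m. k < length (P m) \<and> (\<forall>i\<le>k. P m ! i = G i)}"
    and forward: "\<And>m. n \<le> m \<Longrightarrow> ddist D (last (P n)) (last (P m)) \<noteq> \<infinity>"
  obtains j where "ddist D (last (P n)) (G j) \<noteq> \<infinity>"
proof -
  obtain \<delta> where thin: "\<And>x y z A B C. geodesic_triangle D x y z A B C \<Longrightarrow> thin D \<delta> A B C"
    using hyp by (auto simp: hyperbolic_def)
  define K where "K = nat \<lceil>\<delta>\<rceil>"
  let ?y = "last (P n)"
  have ne: "P m \<noteq> []" for m using P(1) by (auto simp: geodesic_def vwalk_def)
  define F where "F = (\<Union>p \<in> set (P n). {v. ddist D p v \<le> enat K})"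
  have "finite F" unfolding F_def using finite_ddist_le[OF fin] by blast
  then obtain L where "\<And>v. v \<in> {v \<in> F. ddist D ?y v \<noteq> \<infinity>} \<Longrightarrow> ddist D ?y v \<le> enat L"
    using finite_enat_bound[of "{v \<in> F. ddist D ?y v \<noteq> \<infinity>}" "ddist D ?y"] by auto
  then have L: "v \<notin> F" if "ddist D ?y v = enat (Suc L)" for v
    using that by fastforce
  obtain b where b: "ddist D x ?y = enat b"
    using P(1)[of n] P(2)[of n] by (metis geodesic_def)
  define N where "N = b + Suc L + K"
  have "infinite ({m. N < length (P m) \<and> (\<forall>i\<le>N. P m ! i = G i)}
      - ({..<n} \<union> {m. ddist D ?y (last (P m)) \<le> enat (Suc L)}))"
    using lim[of N] injective_escapes[OF fin inj] by (intro Diff_infinite_finite) auto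
  from infinite_imp_nonempty[OF this] obtain m where
    "m \<in> {m. N < length (P m) \<and> (\<forall>i\<le>N. P m ! i = G i)}
      - ({..<n} \<union> {m. ddist D ?y (last (P m)) \<le> enat (Suc L)})" by blast
  then have m: "N < length (P m)" "\<And>i. i \<le> N \<Longrightarrow> P m ! i = G i" "n \<le> m"
      "\<not> ddist D ?y (last (P m)) \<le> enat (Suc L)"
    by auto
  obtain Q where Q: "geodesic D Q" "hd Q = ?y" "last Q = last (P m)"
    using forward[OF m(3)] by (rule geodesic_exists)
  then have "ddist D ?y (last (P m)) = enat (length Q - 1)" by (simp add: geodesic_def)
  then have len: "Suc L < length Q" using m(4) by simp
  define v where "v = Q ! Suc L"
  have v: "v \<in> set Q" using len by (simp add: v_def)
  have yv: "ddist D ?y v = enat (Suc L)"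
  proof -
    have "Q \<noteq> []" using len by auto
    then have "Q ! 0 = ?y" using Q(2) hd_conv_nth[of Q] by simp
    then show ?thesis using geodesic_ddist_nth[OF Q(1) _ len, of 0] by (simp add: v_def)
  qed
  have "x \<in> verts D" "?y \<in> verts D" "last (P m) \<in> verts D"
    using ddist_finite_verts[of D x ?y] ddist_finite_verts(2)[OF forward[OF m(3)]] b by auto
  then have "geodesic_triangle D x ?y (last (P m)) (P n) Q (P m)"
    using P Q by (simp add: geodesic_triangle_def geodesic_between_def)
  from thinD[OF thin[OF this], of Q "P n" "P m"]
  have "set Q \<subseteq> (\<Union>q \<in> set (P n). out_ball D \<delta> q) \<union> (\<Union>q \<in> set (P m). in_ball D \<delta> q)"
    using Q by (simp add: add_mset_commute)
  moreover have "v \<notin> (\<Union>q \<in> set (P n). out_ball D \<delta> q)"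
  proof
    assume "v \<in> (\<Union>q \<in> set (P n). out_ball D \<delta> q)"
    then obtain q where "q \<in> set (P n)" "v \<in> out_ball D \<delta> q" by blast
    then have "v \<in> F" using out_ball_ddist[of v D \<delta> q] by (auto simp: F_def K_def)
    with L[OF yv] show False by blast
  qed
  ultimately obtain w where w: "w \<in> set (P m)" "v \<in> in_ball D \<delta> w" using v by blast
  have vw: "ddist D v w \<le> enat K" using in_ball_ddist[OF w(2)] by (simp add: K_def)
  obtain i where i: "i < length (P m)" "w = P m ! i" using w(1) by (auto simp: in_set_conv_nth)
  have "enat i = ddist D x w"
    using geodesic_ddist_nth[OF P(1)[of m], of 0 i] i P(2)[of m] ne[of m]
    by (simp add: hd_conv_nth)
  also have "\<dots> \<le> ddist D x ?y + (ddist D ?y v + ddist D v w)"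
    using ddist_triangle by (meson add_left_mono order_trans)
  also have "\<dots> \<le> enat b + (enat (Suc L) + enat K)"
    unfolding b yv using vw by (intro add_mono) auto
  finally have "i \<le> N" by (simp add: N_def)
  then have "w = G i" using m(2) i by simp
  moreover have "ddist D ?y w \<noteq> \<infinity>"
  proof (rule ddist_finite_trans)
    show "ddist D ?y v \<noteq> \<infinity>" using yv by simp
    show "ddist D v w \<noteq> \<infinity>" using vw by (cases "ddist D v w") auto
  qed
  ultimately show ?thesis using that by blast
qed

section \<open>Reversing paths far away from a finite set\<close>

text \<open>Both ends of an arc lie in the out-ball of radius 1 around its tail.\<close>

lemma B1_arc_return:
  assumes "B1 D"
  obtains c where "\<And>x y. x \<rightarrow>\<^bsub>D\<^esub> y \<Longrightarrow> ddist D y x \<noteq> \<infinity> \<Longrightarrow> ddist D y x \<le> enat c"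
proof -
  obtain f where f: "\<And>x r y z. x \<in> verts D \<Longrightarrow> r \<ge> 0 \<Longrightarrow> y \<in> out_ball D r x \<Longrightarrow>
      z \<in> out_ball D r x \<Longrightarrow> ddist D y z = \<infinity> \<or> ereal_of_enat (ddist D y z) \<le> ereal (f r)"
    using assms unfolding B1_def by metis
  have "ddist D y x \<le> enat (nat \<lceil>f 1\<rceil>)" if xy: "x \<rightarrow>\<^bsub>D\<^esub> y" and fin: "ddist D y x \<noteq> \<infinity>" for x y
  proof -
    have v: "x \<in> verts D" "y \<in> verts D" using ddist_finite_verts[OF fin] by auto
    have "x \<in> out_ball D (real 1) x" "y \<in> out_ball D (real 1) x"
      unfolding out_ball_nat using v ddist_self[OF v(1)] ddist_arc[OF xy v]
      by (auto simp: one_enat_def)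
    with f[OF v(1), of 1 y x] fin have "ereal_of_enat (ddist D y x) \<le> ereal (f 1)" by simp
    with v have "x \<in> out_ball D (f 1) y" by (simp add: out_ball_def)
    then show ?thesis by (rule out_ball_ddist)
  qed
  then show ?thesis by (rule that)
qed

text \<open>Each arc of the path is reversed by a path of length at most \<open>c\<close>. If that detour met
  \<open>U\<close>, then \<open>U\<close> would be within distance \<open>c\<close> of the original path.\<close>

lemma reverse_path_avoiding:
  assumes c: "\<And>x y. x \<rightarrow>\<^bsub>D\<^esub> y \<Longrightarrow> ddist D y x \<noteq> \<infinity> \<Longrightarrow> ddist D y x \<le> enat c"
    and p: "path_from_to D {x} {y} p"
    and conn: "\<And>v w. v \<in> set p \<Longrightarrow> w \<in> set p \<Longrightarrow> ddist D v w \<noteq> \<infinity>"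
    and far: "\<And>u v. u \<in> U \<Longrightarrow> v \<in> set p \<Longrightarrow> \<not> ddist D u v \<le> enat c"
  shows "reach_avoiding D U y x"
proof -
  have walk: "vwalk p D" "p \<noteq> []" using p by (auto simp: path_from_to_def vwalk_def)
  have "reach_avoiding D U (p ! k) (p ! 0)" if "k < length p" for k
    using that
  proof (induction k)
    case 0
    then have v: "p ! 0 \<in> verts D" using walk(1) by (auto simp: vwalk_def)
    have "p ! 0 \<notin> U" using far[of "p ! 0" "p ! 0"] 0 ddist_self[OF v] by auto
    then show ?case using v
      unfolding reach_avoiding_def by (intro exI[of _ "[p ! 0]"]) (simp add: path_from_to_iff)
  next
    case (Suc k)
    have arc: "p ! k \<rightarrow>\<^bsub>D\<^esub> p ! Suc k" using walk(1) Suc.prems by (simp add: vwalk_iff_nth)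
    have fin: "ddist D (p ! Suc k) (p ! k) \<noteq> \<infinity>" using Suc.prems by (intro conn) auto
    then obtain q where q: "geodesic D q" "hd q = p ! Suc k" "last q = p ! k"
      by (rule geodesic_exists)
    have path: "path_from_to D {p ! Suc k} {p ! k} q" using geodesic_path[OF q(1)] q by simp
    have "u \<notin> U" if "u \<in> set q" for u
    proof
      assume "u \<in> U"
      have "ddist D u (p ! k) \<le> enat (vwalk_length q)" using path_visits(2)[OF path that] .
      also have "\<dots> = ddist D (p ! Suc k) (p ! k)" using q by (simp add: geodesic_def)
      also have "\<dots> \<le> enat c" by (rule c[OF arc fin])
      finally show False using far[OF \<open>u \<in> U\<close>] Suc.prems by (auto simp: Suc_lessD)
    qed
    then have "reach_avoiding D U (p ! Suc k) (p ! k)"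
      using path unfolding reach_avoiding_def by blast
    then show ?case using Suc by (auto intro: reach_avoiding_trans)
  qed
  from this[of "length p - 1"] show ?thesis
    using p walk(2) by (simp add: path_from_to_iff hd_conv_nth last_conv_nth)
qed

text \<open>Suppose that every path from \<open>R\<close> to \<open>G\<close> meets the finite set \<open>U\<close>. Then one \<open>u \<in> U\<close>
  can be reached from all of \<open>R\<close> and reaches \<open>G\<close>, and since \<open>G\<close> leads back to \<open>R\<close>, the vertex
  \<open>u\<close> and tails of \<open>R\<close> and \<open>G\<close> lie in a common strong component. There a path from \<open>G\<close> to
  \<open>R\<close> far away from \<open>U\<close> can be reversed.\<close>

lemma end_le_converse:
  assumes B1: "B1 D" and fin: "finite_out_degrees D"
    and R: "R \<in> rays D" and G: "G \<in> rays D" and GR: "end_le D G R"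
    and reach: "\<And>n. \<exists>j. ddist D (R n) (G j) \<noteq> \<infinity>"
  shows "end_le D R G"
  unfolding end_le_iff
proof (intro allI impI, rule ccontr)
  fix U :: "'a set" assume U: "finite U" and no: "\<nexists>i j. reach_avoiding D U (R i) (G j)"
  have "\<exists>u\<in>U. ddist D (R n) u \<noteq> \<infinity> \<and> (\<exists>j. ddist D u (G j) \<noteq> \<infinity>)" for n
  proof -
    obtain j p where p: "path_from_to D {R n} {G j} p"
      using reach[of n] unfolding ddist_finite_iff by blast
    with no obtain u where "u \<in> set p" "u \<in> U" unfolding reach_avoiding_def by blast
    then show ?thesis using path_visits_finite[OF p] by blast
  qed
  then obtain h where h: "\<And>n. h n \<in> U" "\<And>n. ddist D (R n) (h n) \<noteq> \<infinity>"
      "\<And>n. \<exists>j. ddist D (h n) (G j) \<noteq> \<infinity>" by metis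
  have "finite (range h)" using h(1) U by (meson finite_subset image_subsetI)
  from pigeonhole_infinite[OF infinite_UNIV_nat this] obtain n0 where
    inf: "infinite {n. h n = h n0}" by auto
  define u where "u = h n0"
  have Ru: "ddist D (R n) u \<noteq> \<infinity>" for n
  proof -
    obtain n' where "n \<le> n'" "h n' = u"
      using inf unfolding u_def infinite_nat_iff_unbounded_le by blast
    then show ?thesis
      using ray_forward_finite[OF R \<open>n \<le> n'\<close>] h(2)[of n'] ddist_finite_trans by metis
  qed
  obtain j0 where j0: "ddist D u (G j0) \<noteq> \<infinity>" using h(3) u_def by blast
  have uG: "ddist D u (G j) \<noteq> \<infinity>" if "j0 \<le> j" for j
    using ddist_finite_trans[OF j0 ray_forward_finite[OF G that]] .
  obtain c where c: "\<And>x y. x \<rightarrow>\<^bsub>D\<^esub> y \<Longrightarrow> ddist D y x \<noteq> \<infinity> \<Longrightarrow> ddist D y x \<le> enat c"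
    using B1 by (rule B1_arc_return) blast
  \<comment> \<open>Avoiding the first vertices of \<open>G\<close> makes the path start in the part of \<open>G\<close> reached by \<open>u\<close>.\<close>
  define W where "W = (\<Union>u'\<in>U. {v. ddist D u' v \<le> enat c}) \<union> G ` {..<j0}"
  have "finite W" unfolding W_def using U finite_ddist_le[OF fin] by blast
  then obtain j m p where p: "path_from_to D {G j} {R m} p" "set p \<inter> W = {}"
    using GR unfolding end_le_iff reach_avoiding_def by blast
  then have "p \<noteq> []" "hd p = G j" by (auto simp: path_from_to_def vwalk_def)
  then have "G j \<notin> W" using p(2) hd_in_set by fastforce
  then have j: "j0 \<le> j" by (auto simp: W_def not_less[symmetric])
  have "ddist D u v \<noteq> \<infinity>" "ddist D v u \<noteq> \<infinity>" if "v \<in> set p" for v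
    using path_visits_finite[OF p(1) that] uG[OF j] Ru[of m] ddist_finite_trans by metis+
  then have "ddist D v w \<noteq> \<infinity>" if "v \<in> set p" "w \<in> set p" for v w
    using that ddist_finite_trans by metis
  moreover have "\<not> ddist D u' v \<le> enat c" if "u' \<in> U" "v \<in> set p" for u' v
    using that p(2) unfolding W_def by blast
  ultimately have "reach_avoiding D U (R m) (G j)"
    by (intro reverse_path_avoiding[OF c p(1)]) blast+
  with no show False by blast
qed

section \<open>The boundary refines the ends\<close>

lemma ray_equiv_geodesic_ray:
  assumes hyp: "hyperbolic D" and B1: "B1 D" and fin: "finite_out_degrees D" and R: "R \<in> rays D"
  shows "\<exists>G \<in> geodesic_rays D. end_equiv D R G"
proof -
  have "\<forall>m. \<exists>p. geodesic D p \<and> hd p = R 0 \<and> last p = R m"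
    using geodesic_exists ray_forward_finite[OF R] by (metis zero_le)
  then obtain P where P: "\<And>m. geodesic D (P m)" "\<And>m. hd (P m) = R 0" "\<And>m. last (P m) = R m"
    by metis
  have inj: "inj (\<lambda>m. last (P m))" using R P(3) by (simp add: rays_def)
  obtain G where G: "G \<in> geodesic_rays D"
      and lim: "\<And>k. infinite {m. k < length (P m) \<and> (\<forall>i\<le>k. P m ! i = G i)}"
    using fin P(1,2) inj by (rule geodesic_limit) blast
  have ray: "G \<in> rays D" using G by (simp add: geodesic_rays_def)
  have GR: "end_le D G R"
    using end_le_of_geodesic_limit[OF P(1,2) lim] P(3) by simp
  have "\<exists>j. ddist D (R n) (G j) \<noteq> \<infinity>" for n
    using reaches_geodesic_limit[OF fin hyp P(1,2) inj lim, of n] ray_forward_finite[OF R] P(3)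
    by metis
  then have "end_le D R G" by (rule end_le_converse[OF B1 fin R ray GR])
  with GR G show ?thesis by (auto simp: end_equiv_def)
qed

lemma anti_ray_equiv_geodesic_anti_ray:
  assumes "hyperbolic D" "B2 D" "finite_in_degrees D" "R \<in> anti_rays D"
  shows "\<exists>G \<in> geodesic_anti_rays D. end_equiv D R G"
proof -
  have "finite_out_degrees (reversal D)" "R \<in> rays (reversal D)"
    using assms(3,4) by (simp_all add: finite_out_degrees_reversal rays_reversal)
  from ray_equiv_geodesic_ray[OF hyperbolic_reversal[OF assms(1)] B1_reversal[OF assms(2)] this]
  obtain G where "G \<in> geodesic_rays (reversal D)" "end_equiv (reversal D) R G" ..
  then show ?thesis
    using end_equiv_reversal[of D R G] by (auto simp: geodesic_rays_reversal)
qed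

lemma refinementI:
  assumes "X \<subseteq> Y"
    and finer: "\<And>a b. a \<in> X \<Longrightarrow> b \<in> X \<Longrightarrow> E a b \<Longrightarrow> F a b"
    and trans: "\<And>a b c. a \<in> Y \<Longrightarrow> b \<in> Y \<Longrightarrow> c \<in> Y \<Longrightarrow> F a b \<Longrightarrow> F b c \<Longrightarrow> F a c"
    and rep: "\<And>a. a \<in> Y \<Longrightarrow> \<exists>b\<in>X. F a b"
  shows "refinement (classes_on X E) (classes_on Y F)"
proof -
  define cls where "cls Z H a = {b \<in> Z. a \<in> Z \<and> H a b}" for Z and H :: "'a \<Rightarrow> 'a \<Rightarrow> bool" and a
  have classes: "classes_on Z H = cls Z H ` Z" for Z and H :: "'a \<Rightarrow> 'a \<Rightarrow> bool"
    by (auto simp: classes_on_def quotient_def cls_def Image_def)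
  have "\<exists>\<omega> \<in> cls Y F ` Y. cls X E a \<subseteq> \<omega>" if "a \<in> X" for a
    using that assms(1) finer by (auto simp: cls_def)
  moreover have "\<exists>\<eta> \<in> cls X E ` X. \<eta> \<subseteq> cls Y F a" if a: "a \<in> Y" for a
  proof -
    obtain b where b: "b \<in> X" "F a b" using rep[OF a] by blast
    have "cls X E b \<subseteq> cls Y F a"
      using trans[OF a] b finer assms(1) a unfolding cls_def by blast
    then show ?thesis using b by blast
  qed
  ultimately show ?thesis by (auto simp: refinement_def classes)
qed

lemma geodesic_refinementI:
  assumes "X \<subseteq> Y" "Y \<subseteq> rays D \<union> anti_rays D" "\<And>R. R \<in> Y \<Longrightarrow> \<exists>G\<in>X. end_equiv D R G"
  shows "refinement (classes_on X (geo_equiv D)) (classes_on Y (end_equiv D))"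
proof (rule refinementI[OF assms(1)])
  show "end_equiv D R1 R2" if "R1 \<in> X" "R2 \<in> X" "geo_equiv D R1 R2" for R1 R2
    using that assms(1,2) geo_le_imp_end_le unfolding geo_equiv_def end_equiv_def by blast
  show "end_equiv D R1 R3" if "R1 \<in> Y" "R2 \<in> Y" "R3 \<in> Y" "end_equiv D R1 R2" "end_equiv D R2 R3"
    for R1 R2 R3
    using that assms(2) end_equiv_trans by blast
qed (rule assms(3))

theorem proposition6p3:
  fixes D :: "('a,'b) pre_digraph"
  assumes "wf_digraph D"
    and "hyperbolic D"
    and "B1 D"
    and "B2 D"
  shows "(finite_out_degrees D \<longrightarrow> refinement (geodesic_f_boundary D) (f_ends D)) \<and>
         (finite_in_degrees D \<longrightarrow> refinement (geodesic_b_boundary D) (b_ends D)) \<and>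
         (locally_finite D \<longrightarrow> refinement (geodesic_boundary D) (ends D))"
proof -
  have sub: "geodesic_rays D \<subseteq> rays D" "geodesic_anti_rays D \<subseteq> anti_rays D"
    by (auto simp: geodesic_rays_def geodesic_anti_rays_def)
  have f: "\<exists>G\<in>geodesic_rays D. end_equiv D R G" if "finite_out_degrees D" "R \<in> rays D" for R
    using ray_equiv_geodesic_ray assms that by blast
  have b: "\<exists>G\<in>geodesic_anti_rays D. end_equiv D R G"
    if "finite_in_degrees D" "R \<in> anti_rays D" for R
    using anti_ray_equiv_geodesic_anti_ray assms that by blast
  show ?thesis
    unfolding geodesic_f_boundary_def f_ends_def geodesic_b_boundary_def b_ends_def
      geodesic_boundary_def ends_def locally_finite_def
    using sub f b by (intro conjI impI geodesic_refinementI) blast+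
qed

end
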